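(* Let $G$ be a finite group whose abelianization $G/[G,G]$ is not cyclic. Then every profinite periodic cover of $G$ is an infinite group.
   Context: A periodic presentation of a finite group $G$ is a short exact sequence of groups $1\to R\to F\to G\to 1$ where $F$ is a free product of finitely many finite cyclic groups. Put $[R,_1F]=[R,F]$ and $[R,_{k+1}F]=[[R,_kF],F]$ for $k\ge 1$. The profinite periodic cover of $G$ afforded by this presentation is the inverse limit $E_\infty=\varprojlim_k F/[R,_kF]$ of the inverse system $\cdots\to F/[R,_{k+1}F]\to F/[R,_kF]\to\cdots\to F/[R,F]\to F/R\simeq G$ (natural projections). *)

theory Defs
  imports "HOL-Algebra.Algebra"
begin

section \<open>Free products of groups\<close>

text \<open>
  The free product of a family of groups is the monoid of words in the disjoint union of the
  groups, modulo the congruence generated by deleting identity letters and by multiplying adjacent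
  letters that belong to the same factor. The letter \<open>(i, x)\<close> stands for the element \<open>x\<close> of the
  factor \<open>G i\<close>.
\<close>

definition fp_words :: "'i set \<Rightarrow> ('i \<Rightarrow> ('a, 'b) monoid_scheme) \<Rightarrow> ('i \<times> 'a) list set"
  where "fp_words I G = lists (SIGMA i:I. carrier (G i))"

inductive_set fp_rel :: "'i set \<Rightarrow> ('i \<Rightarrow> ('a, 'b) monoid_scheme) \<Rightarrow> (('i \<times> 'a) list \<times> ('i \<times> 'a) list) set"
  for I :: "'i set" and G :: "'i \<Rightarrow> ('a, 'b) monoid_scheme"
  where
    fp_one: "\<lbrakk>u \<in> fp_words I G; v \<in> fp_words I G; i \<in> I\<rbrakk>
      \<Longrightarrow> (u @ [(i, \<one>\<^bsub>G i\<^esub>)] @ v, u @ v) \<in> fp_rel I G"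
  | fp_mult: "\<lbrakk>u \<in> fp_words I G; v \<in> fp_words I G; i \<in> I; x \<in> carrier (G i); y \<in> carrier (G i)\<rbrakk>
      \<Longrightarrow> (u @ [(i, x), (i, y)] @ v, u @ [(i, x \<otimes>\<^bsub>G i\<^esub> y)] @ v) \<in> fp_rel I G"
  | fp_refl: "u \<in> fp_words I G \<Longrightarrow> (u, u) \<in> fp_rel I G"
  | fp_sym: "(u, v) \<in> fp_rel I G \<Longrightarrow> (v, u) \<in> fp_rel I G"
  | fp_trans: "\<lbrakk>(u, v) \<in> fp_rel I G; (v, w) \<in> fp_rel I G\<rbrakk> \<Longrightarrow> (u, w) \<in> fp_rel I G"

definition free_product :: "'i set \<Rightarrow> ('i \<Rightarrow> ('a, 'b) monoid_scheme) \<Rightarrow> ('i \<times> 'a) list set monoid"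
  where "free_product I G =
    \<lparr>carrier = fp_words I G // fp_rel I G,
     monoid.mult = (\<lambda>A B. \<Union>u\<in>A. \<Union>v\<in>B. fp_rel I G `` {u @ v}),
     one = fp_rel I G `` {[]}\<rparr>"

section \<open>Periodic presentations\<close>

text \<open>
  The exact sequence \<open>1 \<rightarrow> R \<rightarrow> F \<rightarrow> G \<rightarrow> 1\<close> is given by the surjective homomorphism \<open>\<pi>\<close>
  from \<open>F\<close> to \<open>G\<close>; the subgroup \<open>R\<close> of \<open>F\<close> is the kernel of \<open>\<pi>\<close>.
\<close>

definition periodic_presentation ::
    "'i set \<Rightarrow> ('i \<Rightarrow> ('c, 'd) monoid_scheme) \<Rightarrow> ('f, 'e) monoid_scheme \<Rightarrow> ('f \<Rightarrow> 'g)
      \<Rightarrow> ('g, 'h) monoid_scheme \<Rightarrow> bool"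
  where "periodic_presentation I C F \<pi> G \<longleftrightarrow>
    finite I \<and>
    (\<forall>i\<in>I. group (C i) \<and> finite (carrier (C i)) \<and> cyclic_group (C i)) \<and>
    group F \<and> F \<cong> free_product I C \<and>
    \<pi> \<in> epi F G"

section \<open>The series of iterated commutator subgroups\<close>

definition commutator_subgroup :: "('a, 'b) monoid_scheme \<Rightarrow> 'a set \<Rightarrow> 'a set \<Rightarrow> 'a set"
  where "commutator_subgroup F H K =
    generate F {h \<otimes>\<^bsub>F\<^esub> k \<otimes>\<^bsub>F\<^esub> inv\<^bsub>F\<^esub> h \<otimes>\<^bsub>F\<^esub> inv\<^bsub>F\<^esub> k | h k. h \<in> H \<and> k \<in> K}"

text \<open>\<open>iter_commutator F R k\<close> is \<open>[R, \<^sub>k F]\<close>, extended by \<open>R\<close> itself for \<open>k = 0\<close>.\<close>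

primrec iter_commutator :: "('a, 'b) monoid_scheme \<Rightarrow> 'a set \<Rightarrow> nat \<Rightarrow> 'a set"
  where
    "iter_commutator F R 0 = R"
  | "iter_commutator F R (Suc k) = commutator_subgroup F (iter_commutator F R k) (carrier F)"

section \<open>Inverse limits and profinite periodic covers\<close>

text \<open>The inverse limit of the system \<open>\<dots> \<rightarrow> G 2 \<rightarrow> G 1 \<rightarrow> G 0\<close> with bonding maps
  \<open>p k\<close> from \<open>G (Suc k)\<close> to \<open>G k\<close>.\<close>

definition inverse_limit :: "(nat \<Rightarrow> ('a, 'b) monoid_scheme) \<Rightarrow> (nat \<Rightarrow> 'a \<Rightarrow> 'a) \<Rightarrow> (nat \<Rightarrow> 'a) monoid"
  where "inverse_limit G p =
    (product_group UNIV G)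
      \<lparr>carrier := {x \<in> carrier (product_group UNIV G). \<forall>k. p k (x (Suc k)) = x k}\<rparr>"

text \<open>For normal subgroups \<open>M \<subseteq> N\<close> of \<open>F\<close>, the natural projection from \<open>F Mod M\<close> to \<open>F Mod N\<close>
  sends \<open>M #> a\<close> to \<open>N #> a\<close>, which is the union of the cosets \<open>N #> b\<close> over all \<open>b\<close> in
  \<open>M #> a\<close>.\<close>

definition quotient_proj :: "('a, 'b) monoid_scheme \<Rightarrow> 'a set \<Rightarrow> 'a set \<Rightarrow> 'a set"
  where "quotient_proj F N A = (\<Union>b\<in>A. N #>\<^bsub>F\<^esub> b)"

text \<open>The term \<open>F Mod R\<close> (index \<open>0\<close>) is kept as the bottom of the system.\<close>

definition profinite_periodic_cover :: "('a, 'b) monoid_scheme \<Rightarrow> 'a set \<Rightarrow> (nat \<Rightarrow> 'a set) monoid"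
  where "profinite_periodic_cover F R =
    inverse_limit (\<lambda>k. F Mod iter_commutator F R k) (\<lambda>k. quotient_proj F (iter_commutator F R k))"

end

(*
  Every [R,_k F] lies in the term with index k of the lower central series of F, so it suffices to
  find an element w of F and a homomorphism h from F to a residually nilpotent group such that h w
  has infinite order: if the cover were finite, some power of w would lie in all [R,_k F], and hence
  in the kernel of h.

  If the free factors of F had pairwise coprime orders, then every abelian quotient of F would be
  cyclic. So some prime p divides the orders of two different factors C_i and C_j. Let H be the
  semidirect product of the integer-valued functions of period p with the cyclic group of order p
  generated by the shift s. Map C_i onto the complement, C_j onto the conjugate of the complement
  by a delta function, and the other factors to 1. The product of a generator of C_j and the
  inverse of a generator of C_i is mapped to a nonzero periodic function, which has infinite order.
  From its second term on, the lower central series of H lies in the images of the powers of s - 1,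
  which have trivial intersection because (s - 1)^p maps periodic functions to multiples of p.
*)
theory Submission
  imports Defs "HOL-Number_Theory.Cong"
begin

section \<open>Homomorphisms from free products\<close>

lemma fp_rel_words: "(u, v) \<in> fp_rel I G \<Longrightarrow> (\<And>i. i \<in> I \<Longrightarrow> group (G i))
    \<Longrightarrow> u \<in> fp_words I G \<and> v \<in> fp_words I G"
  by (induction rule: fp_rel.induct) (auto simp: fp_words_def group.is_monoid monoid.m_closed)

lemma fp_words_append: "u @ v \<in> fp_words I G \<longleftrightarrow> u \<in> fp_words I G \<and> v \<in> fp_words I G"
  by (auto simp: fp_words_def)

lemma equiv_fp_rel:
  assumes "\<And>i. i \<in> I \<Longrightarrow> group (G i)"
  shows "equiv (fp_words I G) (fp_rel I G)"
proof (rule equivI)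
  show "fp_rel I G \<subseteq> fp_words I G \<times> fp_words I G"
    using fp_rel_words assms by fast
qed (auto intro!: refl_onI symI transI intro: fp_rel.fp_refl fp_rel.fp_sym fp_rel.fp_trans)

text \<open>The rules \<open>fp_one\<close> and \<open>fp_mult\<close> already allow arbitrary words
  on both sides, so a prefix is absorbed into the left one. With the mirror image below, the
  relation is a congruence.\<close>

lemma fp_rel_append_left:
  assumes "(u, v) \<in> fp_rel I G" "w \<in> fp_words I G"
  shows "(w @ u, w @ v) \<in> fp_rel I G"
  using assms
proof (induction rule: fp_rel.induct)
  case (fp_one u v i)
  then show ?case using fp_rel.fp_one[of "w @ u" I G v i] by (simp add: fp_words_append)
next
  case (fp_mult u v i x y)
  then show ?case using fp_rel.fp_mult[of "w @ u" I G v i x y] by (simp add: fp_words_append)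
qed (auto intro: fp_rel.fp_refl fp_rel.fp_sym fp_rel.fp_trans simp: fp_words_append)

lemma fp_rel_append_right:
  assumes "(u, v) \<in> fp_rel I G" "w \<in> fp_words I G"
  shows "(u @ w, v @ w) \<in> fp_rel I G"
  using assms
proof (induction rule: fp_rel.induct)
  case (fp_one u v i)
  then show ?case using fp_rel.fp_one[of u I G "v @ w" i] by (simp add: fp_words_append)
next
  case (fp_mult u v i x y)
  then show ?case using fp_rel.fp_mult[of u I G "v @ w" i x y] by (simp add: fp_words_append)
qed (auto intro: fp_rel.fp_refl fp_rel.fp_sym fp_rel.fp_trans simp: fp_words_append)

text \<open>By the congruence property all classes in the union defining the product
  coincide.\<close>

lemma free_product_mult:
  assumes "\<And>i. i \<in> I \<Longrightarrow> group (G i)" "u \<in> fp_words I G" "v \<in> fp_words I G"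
  shows "(fp_rel I G `` {u}) \<otimes>\<^bsub>free_product I G\<^esub> (fp_rel I G `` {v}) = fp_rel I G `` {u @ v}"
proof -
  note eq = equiv_fp_rel[OF assms(1)]
  have cong: "fp_rel I G `` {u' @ v'} = fp_rel I G `` {u @ v}"
    if "(u, u') \<in> fp_rel I G" "(v, v') \<in> fp_rel I G" for u' v'
  proof (rule equiv_class_eq[OF eq])
    have "u' \<in> fp_words I G"
      using fp_rel_words[OF that(1)] assms(1) by blast
    then show "(u' @ v', u @ v) \<in> fp_rel I G"
      using that assms(3) by (meson fp_rel_append_left fp_rel_append_right fp_rel.fp_sym fp_rel.fp_trans)
  qed
  have "u \<in> fp_rel I G `` {u}" "v \<in> fp_rel I G `` {v}"
    using assms by (auto intro: fp_rel.fp_refl)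
  then have "(\<Union>u'\<in>fp_rel I G `` {u}. \<Union>v'\<in>fp_rel I G `` {v}. fp_rel I G `` {u' @ v'}) = fp_rel I G `` {u @ v}"
    using cong by blast
  then show ?thesis by (simp add: free_product_def)
qed

definition fp_eval :: "('h, 'm) monoid_scheme \<Rightarrow> ('i \<Rightarrow> 'a \<Rightarrow> 'h) \<Rightarrow> ('i \<times> 'a) list \<Rightarrow> 'h"
  where "fp_eval H f w = foldr (\<lambda>(i, x) h. f i x \<otimes>\<^bsub>H\<^esub> h) w \<one>\<^bsub>H\<^esub>"

text \<open>\<open>the_elem\<close> reads off the common value of the evaluation on a class; this is
  meaningful once the evaluation is known to be constant on classes.\<close>

definition fp_lift :: "('h, 'm) monoid_scheme \<Rightarrow> ('i \<Rightarrow> 'a \<Rightarrow> 'h) \<Rightarrow> ('i \<times> 'a) list set \<Rightarrow> 'h"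
  where "fp_lift H f A = the_elem (fp_eval H f ` A)"

lemma fp_eval_Nil [simp]: "fp_eval H f [] = \<one>\<^bsub>H\<^esub>"
  and fp_eval_Cons [simp]: "fp_eval H f ((i, x) # w) = f i x \<otimes>\<^bsub>H\<^esub> fp_eval H f w"
  by (simp_all add: fp_eval_def)

context
  fixes I :: "'i set" and G :: "'i \<Rightarrow> ('a, 'b) monoid_scheme" and H :: "('h, 'm) monoid_scheme"
    and f :: "'i \<Rightarrow> 'a \<Rightarrow> 'h"
  assumes G: "\<And>i. i \<in> I \<Longrightarrow> group (G i)" and H: "group H"
    and f: "\<And>i. i \<in> I \<Longrightarrow> f i \<in> hom (G i) H"
begin

interpretation group H by (rule H)

lemma fp_eval_closed: "w \<in> fp_words I G \<Longrightarrow> fp_eval H f w \<in> carrier H"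
  using f by (induction w) (auto simp: fp_words_def hom_def Pi_iff)

lemma fp_eval_append:
  "u \<in> fp_words I G \<Longrightarrow> v \<in> fp_words I G \<Longrightarrow> fp_eval H f (u @ v) = fp_eval H f u \<otimes>\<^bsub>H\<^esub> fp_eval H f v"
proof (induction u)
  case Nil
  then show ?case by (simp add: fp_eval_closed)
next
  case (Cons a u)
  then obtain i x where a: "a = (i, x)" "i \<in> I" "x \<in> carrier (G i)" "u \<in> fp_words I G"
    by (auto simp: fp_words_def)
  then have "f i x \<in> carrier H" using f by (auto simp: hom_def)
  with a Cons show ?case by (simp add: fp_eval_closed m_assoc)
qed

lemma fp_eval_rel: "(u, v) \<in> fp_rel I G \<Longrightarrow> fp_eval H f u = fp_eval H f v"
proof (induction rule: fp_rel.induct)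
  case (fp_one u v i)
  then have "[(i, \<one>\<^bsub>G i\<^esub>)] \<in> fp_words I G" "f i \<one>\<^bsub>G i\<^esub> = \<one>\<^bsub>H\<^esub>"
    using G group.is_monoid hom_one[OF f G H] by (auto simp: fp_words_def)
  with fp_one show ?case
    using fp_eval_append[of "[(i, \<one>\<^bsub>G i\<^esub>)]" v]
    by (simp add: fp_eval_append fp_words_append fp_eval_closed del: append_Cons)
next
  case (fp_mult u v i x y)
  then have w: "[(i, x), (i, y)] \<in> fp_words I G" "[(i, x \<otimes>\<^bsub>G i\<^esub> y)] \<in> fp_words I G"
    using G group.is_monoid monoid.m_closed by (fastforce simp: fp_words_def)+
  have "f i x \<in> carrier H" "f i y \<in> carrier H" "f i (x \<otimes>\<^bsub>G i\<^esub> y) = f i x \<otimes>\<^bsub>H\<^esub> f i y"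
    using fp_mult f by (auto simp: hom_def)
  then have "fp_eval H f [(i, x), (i, y)] = fp_eval H f [(i, x \<otimes>\<^bsub>G i\<^esub> y)]"
    by simp
  with fp_mult w show ?case
    by (simp add: fp_eval_append fp_words_append del: append_Cons fp_eval_Cons)
qed auto

lemma fp_lift_class: "w \<in> fp_words I G \<Longrightarrow> fp_lift H f (fp_rel I G `` {w}) = fp_eval H f w"
  unfolding fp_lift_def
proof (rule the_elem_image_unique)
  assume "w \<in> fp_words I G"
  then show "fp_rel I G `` {w} \<noteq> {}" using fp_rel.fp_refl by fast
next
  fix v assume "v \<in> fp_rel I G `` {w}"
  then show "fp_eval H f v = fp_eval H f w" using fp_eval_rel[of w v] by auto
qed

text \<open>The existence half of the universal property of the free product.\<close>

lemma fp_lift_hom: "fp_lift H f \<in> hom (free_product I G) H"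
proof (rule homI)
  fix A B assume "A \<in> carrier (free_product I G)" "B \<in> carrier (free_product I G)"
  then obtain u v where "u \<in> fp_words I G" "v \<in> fp_words I G"
    "A = fp_rel I G `` {u}" "B = fp_rel I G `` {v}"
    by (auto simp: free_product_def elim!: quotientE)
  then show "fp_lift H f (A \<otimes>\<^bsub>free_product I G\<^esub> B) = fp_lift H f A \<otimes>\<^bsub>H\<^esub> fp_lift H f B"
    by (simp add: free_product_mult[OF G] fp_lift_class fp_words_append fp_eval_append)
next
  fix A assume "A \<in> carrier (free_product I G)"
  then show "fp_lift H f A \<in> carrier H"
    by (auto simp: free_product_def fp_lift_class fp_eval_closed elim!: quotientE)
qed

end

text \<open>The canonical map of a factor into the free product; \<open>fp_mult\<close> with empty
  context makes it multiplicative.\<close>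

lemma free_product_letter_hom:
  assumes "\<And>i. i \<in> I \<Longrightarrow> group (G i)" "i \<in> I"
  shows "(\<lambda>x. fp_rel I G `` {[(i, x)]}) \<in> hom (G i) (free_product I G)"
proof (rule homI)
  fix x assume "x \<in> carrier (G i)"
  then show "fp_rel I G `` {[(i, x)]} \<in> carrier (free_product I G)"
    using assms(2) by (auto simp: free_product_def fp_words_def intro!: quotientI)
next
  fix x y assume xy: "x \<in> carrier (G i)" "y \<in> carrier (G i)"
  then have w: "[(i, x)] \<in> fp_words I G" "[(i, y)] \<in> fp_words I G"
    using assms(2) by (auto simp: fp_words_def)
  have "([(i, x), (i, y)], [(i, x \<otimes>\<^bsub>G i\<^esub> y)]) \<in> fp_rel I G"
    using fp_rel.fp_mult[of "[]" I G "[]" i x y] assms(2) xy by (simp add: fp_words_def)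
  then show "fp_rel I G `` {[(i, x \<otimes>\<^bsub>G i\<^esub> y)]}
      = fp_rel I G `` {[(i, x)]} \<otimes>\<^bsub>free_product I G\<^esub> fp_rel I G `` {[(i, y)]}"
    using equiv_class_eq[OF equiv_fp_rel, of I G] assms(1) free_product_mult[OF assms(1) w] by simp
qed

section \<open>Iterated commutators and the profinite cover\<close>

text \<open>A commutator is \<open>h\<close> times a conjugate of \<open>inv h\<close>, and both lie
  in the normal subgroup.\<close>

lemma (in normal) commutator_subgroup_subset: "commutator_subgroup G H (carrier G) \<subseteq> H"
proof -
  have "h \<otimes> k \<otimes> inv h \<otimes> inv k \<in> H" if "h \<in> H" "k \<in> carrier G" for h k
    using that inv_op_closed2[of k "inv h"] by (simp add: m_assoc m_closed m_inv_closed)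
  then show ?thesis
    unfolding commutator_subgroup_def
    by (intro generate_subgroup_incl[OF _ subgroup_axioms]) auto
qed

text \<open>Since \<open>x g x^-1 = [g, x]^-1 g\<close> and \<open>[g, x]\<close> is itself a
  generator when \<open>g\<close> lies in \<open>N\<close>, normality follows without conjugating
  the generators.\<close>

lemma (in group) commutator_subgroup_normal:
  assumes "N \<lhd> G"
  shows "commutator_subgroup G N (carrier G) \<lhd> G"
proof -
  interpret N: normal N G by (rule assms)
  let ?S = "{h \<otimes> k \<otimes> inv h \<otimes> inv k | h k. h \<in> N \<and> k \<in> carrier G}"
  have sub: "subgroup (commutator_subgroup G N (carrier G)) G"
    unfolding commutator_subgroup_def by (intro generate_is_subgroup) auto
  show ?thesis
  proof (rule normal_invI[OF sub])
    fix x g assume g: "g \<in> commutator_subgroup G N (carrier G)" and x: "x \<in> carrier G"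
    have gN: "g \<in> N" using g N.commutator_subgroup_subset by auto
    have "g \<otimes> x \<otimes> inv g \<otimes> inv x \<in> commutator_subgroup G N (carrier G)"
      unfolding commutator_subgroup_def using gN x by (intro generate.incl) auto
    then have "inv (g \<otimes> x \<otimes> inv g \<otimes> inv x) \<otimes> g \<in> commutator_subgroup G N (carrier G)"
      using g sub by (meson subgroup.m_closed subgroup.m_inv_closed)
    moreover have "inv (g \<otimes> x \<otimes> inv g \<otimes> inv x) \<otimes> g = x \<otimes> g \<otimes> inv x"
      using x gN by (simp add: inv_mult_group m_assoc)
    ultimately show "x \<otimes> g \<otimes> inv x \<in> commutator_subgroup G N (carrier G)"
      by simp
  qed
qed

lemma (in group) iter_commutator_normal: "R \<lhd> G \<Longrightarrow> iter_commutator G R k \<lhd> G"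
  by (induction k) (auto intro: commutator_subgroup_normal)

lemma (in group) iter_commutator_decreasing:
  "R \<lhd> G \<Longrightarrow> iter_commutator G R (Suc k) \<subseteq> iter_commutator G R k"
  using normal.commutator_subgroup_subset[OF iter_commutator_normal] by simp

text \<open>\<open>L\<close> stands for any series of subgroups that starts at \<open>H\<close> and
  absorbs commutators with \<open>H\<close>, as the lower central series does. The inclusion in
  \<open>carrier F\<close> is carried through the induction so that images of generated subgroups
  can be computed on generators.\<close>

lemma iter_commutator_image:
  assumes "group_hom F H h" "R \<subseteq> carrier F" "L 0 = carrier H" "\<And>k. subgroup (L k) H"
    and comm: "\<And>k a b. a \<in> L k \<Longrightarrow> b \<in> carrier H \<Longrightarrow> a \<otimes>\<^bsub>H\<^esub> b \<otimes>\<^bsub>H\<^esub> inv\<^bsub>H\<^esub> a \<otimes>\<^bsub>H\<^esub> inv\<^bsub>H\<^esub> b \<in> L (Suc k)"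
  shows "iter_commutator F R k \<subseteq> carrier F \<and> h ` iter_commutator F R k \<subseteq> L k"
proof (induction k)
  case 0
  interpret group_hom F H h by fact
  show ?case using assms by auto
next
  case (Suc k)
  interpret group_hom F H h by fact
  let ?S = "{a \<otimes>\<^bsub>F\<^esub> b \<otimes>\<^bsub>F\<^esub> inv\<^bsub>F\<^esub> a \<otimes>\<^bsub>F\<^esub> inv\<^bsub>F\<^esub> b | a b. a \<in> iter_commutator F R k \<and> b \<in> carrier F}"
  have S: "?S \<subseteq> carrier F" using Suc by blast
  have "h ` ?S \<subseteq> L (Suc k)"
  proof clarify
    fix a b assume a: "a \<in> iter_commutator F R k" and b: "b \<in> carrier F"
    with Suc have "h (a \<otimes>\<^bsub>F\<^esub> b \<otimes>\<^bsub>F\<^esub> inv\<^bsub>F\<^esub> a \<otimes>\<^bsub>F\<^esub> inv\<^bsub>F\<^esub> b)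
       = h a \<otimes>\<^bsub>H\<^esub> h b \<otimes>\<^bsub>H\<^esub> inv\<^bsub>H\<^esub> h a \<otimes>\<^bsub>H\<^esub> inv\<^bsub>H\<^esub> h b" by (auto simp: subset_iff)
    also have "\<dots> \<in> L (Suc k)" using Suc a b by (intro comm) auto
    finally show "h (a \<otimes>\<^bsub>F\<^esub> b \<otimes>\<^bsub>F\<^esub> inv\<^bsub>F\<^esub> a \<otimes>\<^bsub>F\<^esub> inv\<^bsub>F\<^esub> b) \<in> L (Suc k)" .
  qed
  then have "h ` generate F ?S \<subseteq> L (Suc k)"
    unfolding generate_img[OF S, symmetric] by (rule H.generate_subgroup_incl[OF _ assms(4)])
  then show ?case
    using G.generate_incl[OF S] by (simp add: commutator_subgroup_def)
qed

lemma inverse_limit_group: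
  assumes "\<And>k. group (Q k)" "\<And>k. p k \<in> hom (Q (Suc k)) (Q k)"
  shows "group (inverse_limit Q p)"
proof -
  interpret P: group "product_group UNIV Q" using assms(1) by simp
  interpret p: group_hom "Q (Suc k)" "Q k" "p k" for k
    using assms by (simp add: group_hom_def group_hom_axioms_def)
  show ?thesis
    unfolding inverse_limit_def
    by (rule subgroup.subgroup_is_group[OF P.subgroupI P.is_group])
      (auto simp: assms(1) group.is_monoid Pi_iff PiE_iff intro!: exI[of _ "\<lambda>k. \<one>\<^bsub>Q k\<^esub>"])
qed

text \<open>As \<open>M\<close> is contained in \<open>N\<close>, all elements of the
  \<open>M\<close>-coset have the same \<open>N\<close>-coset, and the union collapses.\<close>

lemma quotient_proj_coset:
  assumes "group F" "M \<lhd> F" "N \<lhd> F" "M \<subseteq> N" "a \<in> carrier F"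
  shows "quotient_proj F N (M #>\<^bsub>F\<^esub> a) = N #>\<^bsub>F\<^esub> a"
proof -
  interpret group F by fact
  interpret M: normal M F by fact
  interpret N: normal N F by fact
  have "N #>\<^bsub>F\<^esub> b = N #>\<^bsub>F\<^esub> a" if "b \<in> M #>\<^bsub>F\<^esub> a" for b
    using that assms(4,5) repr_independence[OF _ _ N.subgroup_axioms, of b a] N.subset
    unfolding r_coset_def by blast
  moreover have "a \<in> M #>\<^bsub>F\<^esub> a" using assms(5) rcos_self M.subgroup_axioms by blast
  ultimately show ?thesis unfolding quotient_proj_def by blast
qed

lemma quotient_proj_hom:
  assumes "group F" "M \<lhd> F" "N \<lhd> F" "M \<subseteq> N"
  shows "quotient_proj F N \<in> hom (F Mod M) (F Mod N)"
proof -
  interpret group F by fact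
  show ?thesis
    by (intro homI)
      (auto simp: FactGroup_def RCOSETS_def quotient_proj_coset[OF assms]
        normal.rcos_sum[OF assms(2)] normal.rcos_sum[OF assms(3)])
qed

lemma profinite_periodic_cover_group:
  assumes "group F" "R \<lhd> F"
  shows "group (profinite_periodic_cover F R)"
  unfolding profinite_periodic_cover_def
  using assms group.iter_commutator_normal group.iter_commutator_decreasing[OF assms]
  by (intro inverse_limit_group normal.factorgroup_is_group quotient_proj_hom)
    (auto simp del: iter_commutator.simps)

text \<open>These threads form the image of the natural map from \<open>F\<close> to the cover;
  infinitude will be detected on them.\<close>

lemma coset_sequence_in_cover:
  assumes "group F" "R \<lhd> F" "a \<in> carrier F"
  shows "(\<lambda>k. iter_commutator F R k #>\<^bsub>F\<^esub> a) \<in> carrier (profinite_periodic_cover F R)"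
  using quotient_proj_coset[OF assms(1) group.iter_commutator_normal group.iter_commutator_normal
      group.iter_commutator_decreasing] assms
  by (auto simp: profinite_periodic_cover_def inverse_limit_def FactGroup_def RCOSETS_def
      simp del: iter_commutator.simps)

section \<open>Periodic functions and the shift\<close>

text \<open>For positive \<open>p\<close> these are the integer-valued functions on the cyclic group
  of order \<open>p\<close>, encoded on all integers so that a shift is plain addition in the
  argument.\<close>

definition periodic_fun :: "int \<Rightarrow> (int \<Rightarrow> int) set"
  where "periodic_fun p = {f. \<forall>t. f (t + p) = f t}"

lemma periodic_fun_shift:
  assumes "f \<in> periodic_fun p" "[s = t] (mod p)"
  shows "f s = f t"
proof -
  have nat: "f (t + int n * p) = f t" for t n
  proof (induction n)
    case (Suc n)
    have "f (t + int (Suc n) * p) = f ((t + int n * p) + p)" by (simp add: algebra_simps)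
    with Suc assms(1) show ?case by (simp add: periodic_fun_def)
  qed simp
  obtain k where k: "s = t + k * p"
    using assms(2) by (metis cong_iff_lin mult.commute cong_sym)
  show ?thesis
  proof (cases "k \<ge> 0")
    case True
    then show ?thesis using nat[of t "nat k"] k by simp
  next
    \<comment> \<open>Backward shifts reduce to forward ones: \<open>t\<close> is reached from
      \<open>s\<close> by \<open>- k\<close> periods.\<close>
    case False
    then show ?thesis using nat[of s "nat (-k)"] k by simp
  qed
qed

section \<open>The forward difference operator, that is, the shift minus the identity\<close>

definition fdiff :: "(int \<Rightarrow> int) \<Rightarrow> int \<Rightarrow> int"
  where "fdiff f = (\<lambda>t. f (t + 1) - f t)"

lemma fdiff_apply: "fdiff f t = f (t + 1) - f t"
  by (simp add: fdiff_def)

text \<open>The binomial theorem for a power of the shift minus the identity, proved by Pascal's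
  rule on the coefficients.\<close>

lemma fdiff_pow: "(fdiff ^^ n) f t = (\<Sum>k\<le>n. (-1) ^ (n - k) * int (n choose k) * f (t + int k))"
proof (induction n arbitrary: t)
  case (Suc n)
  let ?g = "\<lambda>n k. (-1) ^ (n - k) * int (n choose k)"
  have "(fdiff ^^ Suc n) f t = (\<Sum>k\<le>n. ?g n k * f (t + 1 + int k)) - (\<Sum>k\<le>n. ?g n k * f (t + int k))"
    by (simp only: funpow.simps o_apply fdiff_apply Suc)
  \<comment> \<open>The added term vanishes because \<open>n choose Suc n\<close> is 0; it makes the
    index ranges match after the term at 0 is split off.\<close>
  also have "(\<Sum>k\<le>n. ?g n k * f (t + int k)) = (\<Sum>k\<le>Suc n. ?g n k * f (t + int k))"
    by simp
  also have "\<dots> = (-1) ^ n * f t + (\<Sum>k\<le>n. ?g n (Suc k) * f (t + 1 + int k))"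
    by (subst sum.atMost_Suc_shift) (simp add: algebra_simps)
  also have "(\<Sum>k\<le>n. ?g n k * f (t + 1 + int k)) - ((-1) ^ n * f t + (\<Sum>k\<le>n. ?g n (Suc k) * f (t + 1 + int k)))
    = (-1) ^ Suc n * f t + (\<Sum>k\<le>n. (?g n k - ?g n (Suc k)) * f (t + 1 + int k))"
    by (simp add: sum_subtractf left_diff_distrib)
  also have "(\<Sum>k\<le>n. (?g n k - ?g n (Suc k)) * f (t + 1 + int k))
    = (\<Sum>k\<le>n. ?g (Suc n) (Suc k) * f (t + 1 + int k))"
  proof (rule sum.cong)
    fix k assume "k \<in> {..n}"
    then consider "k = n" | "k < n" by fastforce
    then have "?g n k - ?g n (Suc k) = ?g (Suc n) (Suc k)"
    proof cases
      case 2
      then have "n - k = Suc (n - Suc k)" by simp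
      then show ?thesis by (simp add: algebra_simps)
    qed simp
    then show "(?g n k - ?g n (Suc k)) * f (t + 1 + int k) = ?g (Suc n) (Suc k) * f (t + 1 + int k)" by simp
  qed simp
  also have "(-1) ^ Suc n * f t + (\<Sum>k\<le>n. ?g (Suc n) (Suc k) * f (t + 1 + int k))
    = (\<Sum>k\<le>Suc n. ?g (Suc n) k * f (t + int k))"
    unfolding sum.atMost_Suc_shift by (simp add: ac_simps del: binomial_Suc_Suc)
  finally show ?case .
qed simp

text \<open>Modulo \<open>p\<close> this is \<open>(\<sigma> - 1)^p = \<sigma>^p - 1 = 0\<close>, where \<open>\<sigma>\<close> is the shift.\<close>

lemma fdiff_pow_prime_dvd:
  assumes p: "Factorial_Ring.prime p" and f: "f \<in> periodic_fun (int p)"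
  shows "int p dvd (fdiff ^^ p) f t"
proof -
  have "p > 0" using p by (rule prime_gt_0_nat)
  then obtain q where q: "p = Suc q" using gr0_implies_Suc by blast
  have "(fdiff ^^ p) f t = (\<Sum>k<p. (-1) ^ (p - k) * int (p choose k) * f (t + int k)) + f (t + int p)"
    unfolding fdiff_pow lessThan_Suc_atMost[symmetric] sum.lessThan_Suc by simp
  also have "f (t + int p) = f t" using f by (simp add: periodic_fun_def)
  also have "(\<Sum>k<p. (-1) ^ (p - k) * int (p choose k) * f (t + int k))
     = (-1) ^ p * f t + (\<Sum>k<q. (-1) ^ (p - Suc k) * int (p choose Suc k) * f (t + int (Suc k)))"
    unfolding q by (subst sum.lessThan_Suc_shift) (simp add: ac_simps)
  finally have eq: "(fdiff ^^ p) f t = (\<Sum>k<q. (-1) ^ (p - Suc k) * int (p choose Suc k) * f (t + int (Suc k)))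
     + (1 + (-1) ^ p) * f t" by (simp add: algebra_simps)
  have "int p dvd int (p choose Suc k)" if "k < q" for k
    using that q dvd_choose_prime[of "Suc k" p] p by (simp only: int_dvd_int_iff)
  \<comment> \<open>By periodicity the terms for 0 and \<open>p\<close> combine with coefficient
    \<open>1 + (-1)^p\<close>, which is 2 for \<open>p = 2\<close> and 0 for odd
    \<open>p\<close>.\<close>
  moreover have "int p dvd 1 + (-1) ^ p"
  proof (cases "p = 2")
    case False
    then have "odd p" using p primes_dvd_imp_eq two_is_prime_nat by blast
    then show ?thesis by simp
  qed simp
  ultimately show ?thesis
    unfolding eq by (intro dvd_add[OF dvd_sum dvd_mult2]) (auto intro: dvd_mult2)
qed

lemma fdiff_periodic: "f \<in> periodic_fun p \<Longrightarrow> fdiff f \<in> periodic_fun p"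
  by (simp add: periodic_fun_def fdiff_def) (metis add.commute add.left_commute)

lemma fdiff_pow_periodic: "f \<in> periodic_fun p \<Longrightarrow> (fdiff ^^ n) f \<in> periodic_fun p"
  by (induction n) (auto intro: fdiff_periodic)

lemma fdiff_scale: "fdiff (\<lambda>t. c * f t) = (\<lambda>t. c * fdiff f t)"
  by (simp add: fdiff_def algebra_simps)

lemma fdiff_pow_scale: "(fdiff ^^ n) (\<lambda>t. c * f t) = (\<lambda>t. c * (fdiff ^^ n) f t)"
  by (induction n) (simp_all add: fdiff_scale)

lemma fdiff_pow_add: "(fdiff ^^ n) (\<lambda>t. f t + g t) = (\<lambda>t. (fdiff ^^ n) f t + (fdiff ^^ n) g t)"
  by (induction n) (simp_all add: fdiff_def algebra_simps)

lemma fdiff_pow_uminus: "(fdiff ^^ n) (\<lambda>t. - f t) = (\<lambda>t. - (fdiff ^^ n) f t)"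
  using fdiff_pow_scale[of n "-1" f] by simp

text \<open>A block of \<open>p\<close> differences gives \<open>p\<close> times another
  integer-valued periodic function, so by linearity each further block contributes another factor
  \<open>p\<close>.\<close>

lemma fdiff_pow_prime_power_dvd:
  assumes p: "Factorial_Ring.prime p" and f: "f \<in> periodic_fun (int p)"
  shows "int p ^ m dvd (fdiff ^^ (m * p)) f t"
  using f
proof (induction m arbitrary: f t)
  case (Suc m)
  define g where "g = (\<lambda>t. (fdiff ^^ p) f t div int p)"
  have fg: "(fdiff ^^ p) f = (\<lambda>t. int p * g t)"
    using fdiff_pow_prime_dvd[OF p Suc.prems] by (simp add: g_def)
  have "g \<in> periodic_fun (int p)"
    using fdiff_pow_periodic[OF Suc.prems, of p] by (simp add: g_def periodic_fun_def)
  then have "int p ^ m dvd (fdiff ^^ (m * p)) g t" by (rule Suc.IH)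
  moreover have "(fdiff ^^ (Suc m * p)) f t = int p * (fdiff ^^ (m * p)) g t"
    by (simp add: add.commute[of p] funpow_add fg fdiff_pow_scale)
  ultimately show ?case by simp
qed simp

text \<open>Taking \<open>n = m * p\<close> shows that every power of \<open>p\<close> divides
  \<open>f t\<close>, which is impossible for a nonzero integer.\<close>

lemma fdiff_image_inter_trivial:
  assumes p: "Factorial_Ring.prime p" and f: "\<And>n. f \<in> (fdiff ^^ n) ` periodic_fun (int p)"
  shows "f t = 0"
proof (rule ccontr)
  assume ft: "f t \<noteq> 0"
  have dvd: "int p ^ m dvd f t" for m
    using f[of "m * p"] fdiff_pow_prime_power_dvd[OF p] by auto
  obtain m where "\<bar>f t\<bar> < int p ^ m"
    using prime_gt_1_nat[OF p] real_arch_pow[of "int p" "\<bar>f t\<bar>"]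
    by (metis of_nat_1 of_nat_less_iff of_int_less_iff of_int_of_nat_eq of_int_power real_arch_pow)
  then show False using dvd_imp_le_int[OF ft dvd[of m]] by simp
qed

text \<open>The wreath product of the integers with the cyclic group of order \<open>p\<close>; the representative
  of an exponent modulo \<open>p\<close> in \<open>{0..<p}\<close> acts on a periodic function as a translation.\<close>

definition shift_semidirect :: "int \<Rightarrow> (int \<times> (int \<Rightarrow> int)) monoid"
  where "shift_semidirect p = \<lparr>carrier = {0..<p} \<times> periodic_fun p,
     monoid.mult = (\<lambda>(i, f) (j, g). ((i + j) mod p, \<lambda>t. f t + g (t + i))),
     one = (0, \<lambda>t. 0)\<rparr>"

lemma shift_semidirect_carrier [simp]: "carrier (shift_semidirect p) = {0..<p} \<times> periodic_fun p"
  and shift_semidirect_mult [simp]: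
    "(i, f) \<otimes>\<^bsub>shift_semidirect p\<^esub> (j, g) = ((i + j) mod p, \<lambda>t. f t + g (t + i))"
  and shift_semidirect_one [simp]: "\<one>\<^bsub>shift_semidirect p\<^esub> = (0, \<lambda>t. 0)"
  by (simp_all add: shift_semidirect_def)

lemma periodic_fun_add_shift:
  "f \<in> periodic_fun p \<Longrightarrow> g \<in> periodic_fun p \<Longrightarrow> (\<lambda>t. f t + g (t + i)) \<in> periodic_fun p"
  "f \<in> periodic_fun p \<Longrightarrow> (\<lambda>t. - f (t + i)) \<in> periodic_fun p"
  by (simp_all add: periodic_fun_def) (metis add.commute add.left_commute)+

text \<open>Reduced exponents act as unreduced ones, so the reduction in the first component of the
  semidirect product respects associativity and inverses.\<close>

lemma periodic_fun_mod: "f \<in> periodic_fun p \<Longrightarrow> f (t + i mod p) = f (t + i)"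
  by (rule periodic_fun_shift) (auto simp: cong_def mod_simps)

lemma shift_semidirect_left_inverse:
  assumes "p > 0" "(i, f) \<in> carrier (shift_semidirect p)"
  shows "((- i) mod p, \<lambda>t. - f (t - i)) \<in> carrier (shift_semidirect p)"
    and "((- i) mod p, \<lambda>t. - f (t - i)) \<otimes>\<^bsub>shift_semidirect p\<^esub> (i, f) = \<one>\<^bsub>shift_semidirect p\<^esub>"
  using assms periodic_fun_add_shift(2)[of f p "- i"] periodic_fun_mod[of f p _ "- i"]
  by (auto simp: mod_simps)

lemma shift_semidirect_group:
  assumes "p > 0"
  shows "group (shift_semidirect p)"
proof (rule groupI)
  show "x \<otimes>\<^bsub>shift_semidirect p\<^esub> y \<in> carrier (shift_semidirect p)"
    if "x \<in> carrier (shift_semidirect p)" "y \<in> carrier (shift_semidirect p)" for x y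
    using that assms periodic_fun_add_shift(1) by auto
  show "x \<otimes>\<^bsub>shift_semidirect p\<^esub> y \<otimes>\<^bsub>shift_semidirect p\<^esub> z
      = x \<otimes>\<^bsub>shift_semidirect p\<^esub> (y \<otimes>\<^bsub>shift_semidirect p\<^esub> z)"
    if "x \<in> carrier (shift_semidirect p)" "y \<in> carrier (shift_semidirect p)"
      "z \<in> carrier (shift_semidirect p)" for x y z
    using that periodic_fun_mod[of "snd z" p] by (auto simp: mod_simps algebra_simps)
  show "\<exists>y\<in>carrier (shift_semidirect p). y \<otimes>\<^bsub>shift_semidirect p\<^esub> x = \<one>\<^bsub>shift_semidirect p\<^esub>"
    if "x \<in> carrier (shift_semidirect p)" for x
    using shift_semidirect_left_inverse[OF assms] that by (cases x) blast
qed (use assms in \<open>auto simp: periodic_fun_def\<close>)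

lemma shift_semidirect_inv:
  assumes "p > 0" "(i, f) \<in> carrier (shift_semidirect p)"
  shows "inv\<^bsub>shift_semidirect p\<^esub> (i, f) = ((- i) mod p, \<lambda>t. - f (t - i))"
  using group.inv_equality[OF shift_semidirect_group[OF assms(1)]
      shift_semidirect_left_inverse(2)[OF assms] assms(2) shift_semidirect_left_inverse(1)[OF assms]] .

lemma shift_semidirect_translation_pow:
  "(0, f) [^]\<^bsub>shift_semidirect p\<^esub> (n::nat) = (0, \<lambda>t. int n * f t)"
  by (induction n) (simp_all add: nat_pow_def algebra_simps)

text \<open>With \<open>s\<close> the shift,
  \<open>1 - s^j = -(s - 1)(1 + s + ... + s^(j-1))\<close>, so subtracting a shift of a function
  produces one more difference.\<close>

lemma shift_diff_fdiff_image:
  assumes "j \<ge> 0" "f \<in> (fdiff ^^ n) ` periodic_fun p"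
  shows "(\<lambda>t. f t - f (t + j)) \<in> (fdiff ^^ Suc n) ` periodic_fun p"
proof -
  from assms(2) obtain g where g: "g \<in> periodic_fun p" "f = (fdiff ^^ n) g" by auto
  \<comment> \<open>The cofactor \<open>-(1 + s + ... + s^(j-1))\<close> applied to the preimage
    \<open>g\<close>; its difference telescopes.\<close>
  define G where "G = (\<lambda>t. - (\<Sum>i<nat j. g (t + int i)))"
  have "g (t + p + i) = g (t + i)" for t i
    using g(1) by (simp add: periodic_fun_def) (metis add.assoc add.commute)
  then have G: "G \<in> periodic_fun p"
    by (simp add: G_def periodic_fun_def)
  have shift: "(fdiff ^^ n) (\<lambda>t. g (t + c)) = (\<lambda>t. (fdiff ^^ n) g (t + c))" for c
    unfolding fdiff_pow fun_eq_iff by (simp add: ac_simps)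
  have "fdiff G = (\<lambda>t. g t + - g (t + j))"
  proof
    fix t
    have "g t - g (t + int (nat j)) = (\<Sum>i<nat j. g (t + int i)) - (\<Sum>i<nat j. g (t + 1 + int i))"
      using sum_lessThan_telescope'[of "\<lambda>i. g (t + int i)" "nat j"]
      by (simp add: sum_subtractf ac_simps)
    then show "fdiff G t = g t + - g (t + j)"
      using assms(1) by (simp add: fdiff_apply G_def)
  qed
  then have "(fdiff ^^ Suc n) G = (fdiff ^^ n) (\<lambda>t. g t + - g (t + j))"
    by (simp only: funpow_Suc_right o_apply)
  also have "\<dots> = (\<lambda>t. f t - f (t + j))"
    by (simp only: fdiff_pow_add fdiff_pow_uminus shift g(2) diff_conv_add_uminus)
  finally show ?thesis using G by (intro image_eqI) (rule sym)
qed

text \<open>An upper bound for the lower central series. The exponent of the difference lags one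
  behind the index: term 0 is the whole group and term 1 consists of all translations.\<close>

definition shift_series :: "int \<Rightarrow> nat \<Rightarrow> (int \<times> (int \<Rightarrow> int)) set"
  where "shift_series p k = (case k of 0 \<Rightarrow> carrier (shift_semidirect p)
     | Suc n \<Rightarrow> {0} \<times> (fdiff ^^ n) ` periodic_fun p)"

lemma shift_series_subgroup:
  assumes "p > 0"
  shows "subgroup (shift_series p k) (shift_semidirect p)"
proof -
  interpret group "shift_semidirect p" by (rule shift_semidirect_group[OF assms])
  show ?thesis
  proof (cases k)
    case 0
    then show ?thesis by (simp add: shift_series_def subgroup_self del: shift_semidirect_carrier)
  next
    case (Suc n)
    have S: "shift_series p k = {0} \<times> (fdiff ^^ n) ` periodic_fun p"
      by (simp add: shift_series_def Suc)
    have sub: "shift_series p k \<subseteq> carrier (shift_semidirect p)"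
      using assms by (auto simp: S fdiff_pow_periodic)
    show ?thesis
    proof (rule subgroupI[OF sub])
      show "shift_series p k \<noteq> {}" by (auto simp: S periodic_fun_def)
    next
      fix a assume a: "a \<in> shift_series p k"
      then obtain g where g: "g \<in> periodic_fun p" "a = (0, (fdiff ^^ n) g)" by (auto simp: S)
      then have "inv\<^bsub>shift_semidirect p\<^esub> a = (0, \<lambda>t. - (fdiff ^^ n) g t)"
        using shift_semidirect_inv[OF assms] a sub by auto
      also have "\<dots> = (0, (fdiff ^^ n) (\<lambda>t. - g t))" by (simp add: fdiff_pow_uminus)
      finally show "inv\<^bsub>shift_semidirect p\<^esub> a \<in> shift_series p k"
        using g(1) by (auto simp: S periodic_fun_def)
    next
      fix a b assume "a \<in> shift_series p k" "b \<in> shift_series p k"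
      then obtain f g where "f \<in> periodic_fun p" "a = (0, (fdiff ^^ n) f)"
        "g \<in> periodic_fun p" "b = (0, (fdiff ^^ n) g)" by (auto simp: S)
      moreover from this have "a \<otimes>\<^bsub>shift_semidirect p\<^esub> b = (0, (fdiff ^^ n) (\<lambda>t. f t + g t))"
        by (simp add: fdiff_pow_add)
      ultimately show "a \<otimes>\<^bsub>shift_semidirect p\<^esub> b \<in> shift_series p k"
        by (auto simp: S periodic_fun_def)
    qed
  qed
qed

text \<open>The quotient by the translations is abelian, so every commutator is a translation; this
  settles \<open>k = 0\<close>. The commutator of a translation \<open>f\<close> with
  \<open>(j, g)\<close> is \<open>f\<close> minus its shift by \<open>j\<close>, since the
  contributions of \<open>g\<close> cancel.\<close>

lemma shift_series_commutator:
  assumes "p > 0" "a \<in> shift_series p k" "b \<in> carrier (shift_semidirect p)"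
  shows "a \<otimes>\<^bsub>shift_semidirect p\<^esub> b \<otimes>\<^bsub>shift_semidirect p\<^esub> inv\<^bsub>shift_semidirect p\<^esub> a
     \<otimes>\<^bsub>shift_semidirect p\<^esub> inv\<^bsub>shift_semidirect p\<^esub> b \<in> shift_series p (Suc k)"
    (is "?c \<in> _")
proof -
  interpret group "shift_semidirect p" by (rule shift_semidirect_group[OF assms(1)])
  have a: "a \<in> carrier (shift_semidirect p)"
    using shift_series_subgroup[OF assms(1)] assms(2) by (meson subgroup.mem_carrier)
  obtain i f j g where ab: "a = (i, f)" "b = (j, g)" by (cases a, cases b)
  have "fst ?c = 0"
    using ab a assms shift_semidirect_inv[OF assms(1)] by (simp add: mod_simps)
  moreover have "?c \<in> carrier (shift_semidirect p)"
    using a assms(3) by blast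
  ultimately have c: "?c \<in> {0} \<times> periodic_fun p" by (cases ?c) auto
  show ?thesis
  proof (cases k)
    case 0
    then show ?thesis using c by (simp add: shift_series_def)
  next
    case (Suc n)
    with assms(2) ab have i: "i = 0" and f: "f \<in> (fdiff ^^ n) ` periodic_fun p"
      by (auto simp: shift_series_def)
    have j: "0 \<le> j" "j < p" and fp: "f \<in> periodic_fun p" and g: "g \<in> periodic_fun p"
      using assms(3) a ab by auto
    have "?c = (0, \<lambda>t. f t - f (t + j))"
      using shift_semidirect_inv[OF assms(1)] a assms(3) j periodic_fun_mod
      by (simp add: ab i mod_simps)
    then show ?thesis
      using shift_diff_fdiff_image[OF j(1) f] by (simp add: shift_series_def Suc)
  qed
qed

text \<open>The homomorphism is \<open>\<chi>\<close> into the complement, conjugated by the translation \<open>c\<close>; so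
  it is well defined with no condition on \<open>c\<close>.\<close>

lemma affine_hom:
  assumes "p > 0" "c \<in> periodic_fun p"
    and \<chi>: "\<And>x y. x \<in> carrier C \<Longrightarrow> y \<in> carrier C \<Longrightarrow> [\<chi> (x \<otimes>\<^bsub>C\<^esub> y) = \<chi> x + \<chi> y] (mod p)"
  shows "(\<lambda>x. (\<chi> x mod p, \<lambda>t. c t - c (t + \<chi> x))) \<in> hom C (shift_semidirect p)"
proof (rule homI)
  fix x assume "x \<in> carrier C"
  show "(\<chi> x mod p, \<lambda>t. c t - c (t + \<chi> x)) \<in> carrier (shift_semidirect p)"
    using assms periodic_fun_add_shift(1)[OF assms(2) periodic_fun_add_shift(2)[OF assms(2), of "\<chi> x"], of 0]
    by simp
next
  fix x y assume "x \<in> carrier C" "y \<in> carrier C"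
  note \<chi>xy = \<chi>[OF this]
  have "c (t + \<chi> (x \<otimes>\<^bsub>C\<^esub> y)) = c (t + (\<chi> x + \<chi> y))" for t
    using \<chi>xy by (intro periodic_fun_shift[OF assms(2)]) (simp add: cong_add_lcancel)
  moreover have "c (t + \<chi> x mod p) = c (t + \<chi> x)"
    "c (t + \<chi> x mod p + \<chi> y) = c (t + (\<chi> x + \<chi> y))" for t
    using periodic_fun_mod[OF assms(2)] periodic_fun_mod[OF assms(2), of "t + \<chi> y" "\<chi> x"]
    by (auto simp: ac_simps)
  ultimately show "(\<chi> (x \<otimes>\<^bsub>C\<^esub> y) mod p, \<lambda>t. c t - c (t + \<chi> (x \<otimes>\<^bsub>C\<^esub> y)))
    = (\<chi> x mod p, \<lambda>t. c t - c (t + \<chi> x)) \<otimes>\<^bsub>shift_semidirect p\<^esub> (\<chi> y mod p, \<lambda>t. c t - c (t + \<chi> y))"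
    using \<chi>xy by (simp add: cong_def mod_simps)
qed

section \<open>Prime divisors of the orders of the factors\<close>

text \<open>Exponents of equal powers of \<open>x\<close> differ by a multiple of
  \<open>ord x\<close>, hence of \<open>p\<close>. So an arbitrarily chosen discrete logarithm to
  the base \<open>x\<close> is additive modulo \<open>p\<close>.\<close>

lemma (in group) finite_order_log:
  assumes x: "x \<in> carrier G" and gen: "carrier G = range (\<lambda>n::int. x [^] n)" and p: "p dvd ord x"
  obtains \<chi> :: "'a \<Rightarrow> int" where
    "\<And>y z. y \<in> carrier G \<Longrightarrow> z \<in> carrier G \<Longrightarrow> [\<chi> (y \<otimes> z) = \<chi> y + \<chi> z] (mod int p)"
    "[\<chi> x = 1] (mod int p)"
proof -
  define \<chi> where "\<chi> y = (SOME n::int. y = x [^] n)" for y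
  have log: "y = x [^] \<chi> y" if "y \<in> carrier G" for y
    unfolding \<chi>_def using that gen by (intro someI_ex[of "\<lambda>n::int. y = x [^] n"]) auto
  have cong: "[m = n] (mod int p)" if "x [^] m = x [^] n" for m n :: int
    using that x p int_pow_eq[of x n m] by (metis cong_iff_dvd_diff dvd_trans int_dvd_int_iff)
  show thesis
  proof (rule that)
    fix y z assume yz: "y \<in> carrier G" "z \<in> carrier G"
    have "x [^] \<chi> (y \<otimes> z) = y \<otimes> z" using log yz by simp
    also have "\<dots> = x [^] \<chi> y \<otimes> x [^] \<chi> z" using log yz by simp
    also have "\<dots> = x [^] (\<chi> y + \<chi> z)" using x by (simp add: int_pow_mult)
    finally show "[\<chi> (y \<otimes> z) = \<chi> y + \<chi> z] (mod int p)" by (rule cong)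
  next
    have "x [^] \<chi> x = x [^] (1::int)" using log x by (simp add: int_pow_1)
    then show "[\<chi> x = 1] (mod int p)" by (rule cong)
  qed
qed

lemma (in group) nat_pow_cong:
  assumes "x \<in> carrier G" "x [^] n = \<one>" "[k = l] (mod n)"
  shows "x [^] k = x [^] (l::nat)"
proof -
  have "int (ord x) dvd int l - int k"
    using assms pow_eq_id[of x n] by (meson cong_iff_dvd_diff cong_int_iff cong_sym dvd_trans int_dvd_int_iff)
  then have "x [^] int k = x [^] int l"
    using assms(1) int_pow_eq by blast
  then show ?thesis by (simp add: int_pow_int)
qed

text \<open>The product of the \<open>b i\<close> serves as the root. The equation killing its power
  by the product of the \<open>n i\<close> is carried along so that coprimality can be used again in
  the induction.\<close>

lemma (in comm_group) common_root_of_coprime_orders: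
  fixes n :: "'i \<Rightarrow> nat"
  assumes "finite J" "\<And>i. i \<in> J \<Longrightarrow> b i \<in> carrier G" "\<And>i. i \<in> J \<Longrightarrow> b i [^] n i = \<one>"
    and "\<And>i j. i \<in> J \<Longrightarrow> j \<in> J \<Longrightarrow> i \<noteq> j \<Longrightarrow> coprime (n i) (n j)"
  shows "\<exists>c\<in>carrier G. c [^] (\<Prod>i\<in>J. n i) = \<one> \<and> (\<forall>i\<in>J. \<exists>e::nat. b i = c [^] e)"
  using assms
proof (induction J)
  case empty
  then show ?case by auto
next
  case (insert j J)
  let ?N = "\<Prod>i\<in>J. n i"
  from insert obtain c where c: "c \<in> carrier G" "c [^] ?N = \<one>" "\<forall>i\<in>J. \<exists>e::nat. b i = c [^] e"
    by auto
  have bj: "b j \<in> carrier G" "b j [^] n j = \<one>" using insert.prems by auto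
  have cop: "coprime ?N (n j)"
    using insert by (intro prod_coprime_left) auto
  \<comment> \<open>Raising \<open>c \<otimes> b j\<close> to the power \<open>e\<close> keeps
    \<open>c\<close> and kills \<open>b j\<close>; the power \<open>f\<close> does the
    opposite.\<close>
  obtain e f :: nat where e: "[e = 1] (mod ?N)" "[e = 0] (mod n j)"
    and f: "[f = 0] (mod ?N)" "[f = 1] (mod n j)"
    using binary_chinese_remainder_nat[OF cop] by metis
  have ce: "c = (c \<otimes> b j) [^] e"
    using nat_pow_cong[OF c(1,2) e(1)] nat_pow_cong[OF bj e(2)] c bj by (simp add: nat_pow_distrib)
  have bf: "b j = (c \<otimes> b j) [^] f"
    using nat_pow_cong[OF c(1,2) f(1)] nat_pow_cong[OF bj f(2)] c bj by (simp add: nat_pow_distrib)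
  have "\<exists>k::nat. b i = (c \<otimes> b j) [^] k" if "i \<in> J" for i
    using c that ce bj by (metis m_closed nat_pow_pow)
  moreover have "(c \<otimes> b j) [^] (n j * ?N) = \<one>"
  proof -
    have "c [^] (n j * ?N) = \<one>" "b j [^] (n j * ?N) = \<one>"
      using nat_pow_cong[OF c(1,2), of "n j * ?N" 0] nat_pow_cong[OF bj, of "n j * ?N" 0]
      by (simp_all add: cong_0_iff)
    then show ?thesis using c bj by (simp add: nat_pow_distrib)
  qed
  ultimately show ?case
    using insert.hyps c(1) bj(1) bf by (intro bexI[of _ "c \<otimes> b j"]) auto
qed

text \<open>The images of the generators \<open>a i\<close> are all powers of one \<open>c\<close>,
  and since \<open>f\<close> is onto, \<open>c\<close> generates \<open>Q\<close>. Used in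
  contrapositive form to find two factors whose orders share a prime.\<close>

lemma cyclic_quotient_of_coprime_free_product:
  assumes I: "finite I" and C: "\<And>i. i \<in> I \<Longrightarrow> group (C i)"
    and a: "\<And>i. i \<in> I \<Longrightarrow> a i \<in> carrier (C i)"
    and gen: "\<And>i. i \<in> I \<Longrightarrow> carrier (C i) = range (\<lambda>n::int. a i [^]\<^bsub>C i\<^esub> n)"
    and cop: "\<And>i j. i \<in> I \<Longrightarrow> j \<in> I \<Longrightarrow> i \<noteq> j \<Longrightarrow> coprime (group.ord (C i) (a i)) (group.ord (C j) (a j))"
    and Q: "comm_group Q" and f: "f \<in> epi (free_product I C) Q"
  shows "cyclic_group Q"
proof -
  interpret Q: comm_group Q by (rule Q)
  have fhom: "f \<in> hom (free_product I C) Q" using f by (simp add: epi_def)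
  define \<beta> where "\<beta> = (\<lambda>i x. f (fp_rel I C `` {[(i, x)]}))"
  have hom: "group_hom (C i) Q (\<beta> i)" if "i \<in> I" for i
  proof -
    have "(\<lambda>x. f (fp_rel I C `` {[(i, x)]})) \<in> hom (C i) Q"
      using hom_compose[OF free_product_letter_hom[of I C i] fhom] C that by (simp add: o_def)
    then show ?thesis
      using C that by (simp add: \<beta>_def group_hom_def group_hom_axioms_def Q.is_group)
  qed
  have \<beta>a: "\<beta> i (a i) \<in> carrier Q" "\<beta> i (a i) [^]\<^bsub>Q\<^esub> group.ord (C i) (a i) = \<one>\<^bsub>Q\<^esub>" if "i \<in> I" for i
  proof -
    interpret group_hom "C i" Q "\<beta> i" by (rule hom[OF that])
    show "\<beta> i (a i) \<in> carrier Q" using a[OF that] by simp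
    show "\<beta> i (a i) [^]\<^bsub>Q\<^esub> group.ord (C i) (a i) = \<one>\<^bsub>Q\<^esub>"
      using a[OF that] by (simp flip: hom_nat_pow)
  qed
  have "\<exists>c\<in>carrier Q. c [^]\<^bsub>Q\<^esub> (\<Prod>i\<in>I. group.ord (C i) (a i)) = \<one>\<^bsub>Q\<^esub>
      \<and> (\<forall>i\<in>I. \<exists>e::nat. \<beta> i (a i) = c [^]\<^bsub>Q\<^esub> e)"
    by (rule Q.common_root_of_coprime_orders[OF I \<beta>a cop])
  then obtain c where c: "c \<in> carrier Q" "\<And>i. i \<in> I \<Longrightarrow> \<exists>e::nat. \<beta> i (a i) = c [^]\<^bsub>Q\<^esub> e"
    by blast
  let ?S = "range (\<lambda>n::int. c [^]\<^bsub>Q\<^esub> n)"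
  have letter: "\<beta> i x \<in> ?S" if ix: "i \<in> I" "x \<in> carrier (C i)" for i x
  proof -
    interpret group_hom "C i" Q "\<beta> i" by (rule hom[OF that(1)])
    obtain k :: int where k: "x = a i [^]\<^bsub>C i\<^esub> k" using gen ix by blast
    obtain e :: nat where e: "\<beta> i (a i) = c [^]\<^bsub>Q\<^esub> e" using c(2) ix by blast
    have "\<beta> i x = (c [^]\<^bsub>Q\<^esub> int e) [^]\<^bsub>Q\<^esub> k"
      using a[OF that(1)] e by (simp add: k hom_int_pow int_pow_int)
    also have "\<dots> = c [^]\<^bsub>Q\<^esub> (int e * k)"
      using c(1) by (simp add: Q.int_pow_pow)
    finally show ?thesis by blast
  qed
  have word: "f (fp_rel I C `` {w}) \<in> ?S" if "w \<in> fp_words I C" for w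
    using that
  proof (induction w)
    case Nil
    let ?e = "fp_rel I C `` {[]}"
    have e: "?e \<in> carrier (free_product I C)"
      using Nil by (auto simp: free_product_def intro: quotientI)
    \<comment> \<open>The empty word gives an idempotent, and the only idempotent of the group
      \<open>Q\<close> is its identity; this way only multiplicativity of \<open>f\<close>
      enters.\<close>
    have "?e \<otimes>\<^bsub>free_product I C\<^esub> ?e = ?e"
      using free_product_mult[OF C Nil Nil] by simp
    then have "f ?e \<otimes>\<^bsub>Q\<^esub> f ?e = f ?e"
      using hom_mult[OF fhom e e] by simp
    then have "f ?e = \<one>\<^bsub>Q\<^esub>"
      using hom_in_carrier[OF fhom e] by simp
    then show ?case by (intro range_eqI[of _ _ 0]) simp
  next
    case (Cons l w)
    then obtain i x where l: "l = (i, x)" "i \<in> I" "x \<in> carrier (C i)" and w: "w \<in> fp_words I C"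
      by (auto simp: fp_words_def)
    have lw: "[l] \<in> fp_words I C" using l by (auto simp: fp_words_def)
    have "fp_rel I C `` {[l]} \<in> carrier (free_product I C)" "fp_rel I C `` {w} \<in> carrier (free_product I C)"
      using lw w by (auto simp: free_product_def intro: quotientI)
    then have "f (fp_rel I C `` {l # w}) = \<beta> i x \<otimes>\<^bsub>Q\<^esub> f (fp_rel I C `` {w})"
      using free_product_mult[OF C lw w, symmetric] fhom by (simp add: \<beta>_def l(1) hom_mult)
    moreover obtain m n :: int where "\<beta> i x = c [^]\<^bsub>Q\<^esub> m" "f (fp_rel I C `` {w}) = c [^]\<^bsub>Q\<^esub> n"
      using letter[OF l(2,3)] Cons.IH[OF w] by blast
    ultimately have "f (fp_rel I C `` {l # w}) = c [^]\<^bsub>Q\<^esub> (m + n)"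
      using c(1) by (simp add: Q.int_pow_mult)
    then show ?case by blast
  qed
  have "f A \<in> ?S" if "A \<in> carrier (free_product I C)" for A
    using that word by (auto simp: free_product_def elim!: quotientE)
  moreover have "carrier Q = f ` carrier (free_product I C)"
    using f by (simp add: epi_def)
  ultimately have "carrier Q \<subseteq> ?S" by (simp only: image_subset_iff Ball_def) simp
  then have "carrier Q = ?S" using c(1) by auto
  then show ?thesis using Q.cyclic_group c(1) by blast
qed

text \<open>Both generators have exponent 1 modulo \<open>p\<close>, so the exponents cancel in
  \<open>?w\<close>, and what remains is the periodic delta function minus a shift of it.\<close>

lemma free_product_shift_semidirect_hom:
  fixes p :: nat
  assumes p: "Factorial_Ring.prime p" and C: "\<And>i. i \<in> I \<Longrightarrow> group (C i)"
    and ij: "i \<in> I" "j \<in> I" "i \<noteq> j"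
    and a: "\<And>i. i \<in> I \<Longrightarrow> a i \<in> carrier (C i)"
    and gen: "\<And>i. i \<in> I \<Longrightarrow> carrier (C i) = range (\<lambda>n::int. a i [^]\<^bsub>C i\<^esub> n)"
    and dvd: "p dvd group.ord (C i) (a i)" "p dvd group.ord (C j) (a j)"
  shows "\<exists>h\<in>hom (free_product I C) (shift_semidirect (int p)).
    \<exists>w\<in>carrier (free_product I C). \<exists>u. h w = (0, u) \<and> u 0 \<noteq> 0"
proof -
  let ?H = "shift_semidirect (int p)"
  have p1: "int p > 1" using prime_gt_1_nat[OF p] by simp
  then have p0: "int p > 0" by simp
  interpret H: group ?H by (rule shift_semidirect_group[OF p0])
  obtain \<chi>i where \<chi>i: "\<And>y z. y \<in> carrier (C i) \<Longrightarrow> z \<in> carrier (C i) \<Longrightarrow> [\<chi>i (y \<otimes>\<^bsub>C i\<^esub> z) = \<chi>i y + \<chi>i z] (mod int p)"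
    "[\<chi>i (a i) = 1] (mod int p)"
    by (rule group.finite_order_log[OF C[OF ij(1)] a[OF ij(1)] gen[OF ij(1)] dvd(1)]) (rule that)
  obtain \<chi>j where \<chi>j: "\<And>y z. y \<in> carrier (C j) \<Longrightarrow> z \<in> carrier (C j) \<Longrightarrow> [\<chi>j (y \<otimes>\<^bsub>C j\<^esub> z) = \<chi>j y + \<chi>j z] (mod int p)"
    "[\<chi>j (a j) = 1] (mod int p)"
    by (rule group.finite_order_log[OF C[OF ij(2)] a[OF ij(2)] gen[OF ij(2)] dvd(2)]) (rule that)
  define \<delta> :: "int \<Rightarrow> int" where "\<delta> t = (if int p dvd t then 1 else 0)" for t
  have \<delta>: "\<delta> \<in> periodic_fun (int p)" and zero: "(\<lambda>t. 0) \<in> periodic_fun (int p)"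
    by (simp_all add: \<delta>_def periodic_fun_def)
  \<comment> \<open>\<open>0 - 0\<close> is the form that \<open>affine_hom\<close> yields for the
    zero translation, so one lemma covers both factors.\<close>
  define \<phi> where "\<phi> k = (if k = i then (\<lambda>x. (\<chi>i x mod int p, \<lambda>t::int. 0 - 0 :: int))
    else if k = j then (\<lambda>x. (\<chi>j x mod int p, \<lambda>t. \<delta> t - \<delta> (t + \<chi>j x)))
    else (\<lambda>x. \<one>\<^bsub>?H\<^esub>))" for k
  have "(\<lambda>x. \<one>\<^bsub>?H\<^esub>) \<in> hom (C k) ?H" for k
    by (rule homI) (use p0 zero in auto)
  then have \<phi>: "\<phi> k \<in> hom (C k) ?H" if "k \<in> I" for k
    using affine_hom[OF p0 zero \<chi>i(1)] affine_hom[OF p0 \<delta> \<chi>j(1)]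
    unfolding \<phi>_def by (simp del: shift_semidirect_one)
  interpret i: group_hom "C i" ?H "\<phi> i"
    using C ij \<phi> by (simp add: group_hom_def group_hom_axioms_def H.is_group)
  have inv_a: "inv\<^bsub>C i\<^esub> a i \<in> carrier (C i)" using a ij by simp
  let ?w = "[(j, a j), (i, inv\<^bsub>C i\<^esub> a i)]"
  have w: "?w \<in> fp_words I C" using a ij inv_a by (auto simp: fp_words_def)
  have \<phi>a: "\<phi> i (a i) = (1, \<lambda>t. 0)" "\<phi> j (a j) = (1, \<lambda>t. \<delta> t - \<delta> (t + \<chi>j (a j)))"
    using \<chi>i(2) \<chi>j(2) p1 ij by (auto simp: \<phi>_def cong_def)
  have "(1, \<lambda>t. 0) \<in> carrier ?H" using zero p1 by simp
  then have "\<phi> i (inv\<^bsub>C i\<^esub> a i) = ((- 1) mod int p, \<lambda>t. 0)"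
    using a ij shift_semidirect_inv[OF p0, of 1 "\<lambda>t. 0"] by (simp add: \<phi>a(1))
  moreover have "\<phi> i (inv\<^bsub>C i\<^esub> a i) \<in> carrier ?H" "\<phi> j (a j) \<in> carrier ?H"
    using inv_a a[OF ij(2)] \<phi>[OF ij(1)] \<phi>[OF ij(2)] by (auto simp: hom_def simp del: shift_semidirect_carrier)
  ultimately have eval: "fp_eval ?H \<phi> ?w = (0, \<lambda>t. \<delta> t - \<delta> (t + \<chi>j (a j)))"
    using p1 by (simp add: \<phi>a(2) mod_add_right_eq)
  \<comment> \<open>The shift is by 1 modulo \<open>p\<close>, so the delta function is 0 at the
    shifted point but 1 at 0.\<close>
  have "\<not> int p dvd \<chi>j (a j)"
    using p1 cong_dvd_iff[OF \<chi>j(2)] by simp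
  then have "\<delta> 0 - \<delta> (0 + \<chi>j (a j)) \<noteq> 0" by (simp add: \<delta>_def)
  moreover have "fp_lift ?H \<phi> (fp_rel I C `` {?w}) = (0, \<lambda>t. \<delta> t - \<delta> (t + \<chi>j (a j)))"
    unfolding eval[symmetric] by (rule fp_lift_class[OF C H.is_group \<phi> w])
  moreover have "fp_rel I C `` {?w} \<in> carrier (free_product I C)"
    using w by (auto simp: free_product_def intro: quotientI)
  moreover have "fp_lift ?H \<phi> \<in> hom (free_product I C) ?H"
    by (rule fp_lift_hom[OF C H.is_group \<phi>])
  ultimately show ?thesis by blast
qed

section \<open>From an element of infinite order in the image to an infinite cover\<close>

lemma infinite_profinite_periodic_cover:
  fixes p :: nat
  assumes p: "Factorial_Ring.prime p" and F: "group F" and R: "R \<lhd> F"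
    and h: "h \<in> hom F (shift_semidirect (int p))"
    and w: "w \<in> carrier F" "h w = (0, u)" "u 0 \<noteq> 0"
  shows "infinite (carrier (profinite_periodic_cover F R))"
proof
  assume fin: "finite (carrier (profinite_periodic_cover F R))"
  interpret F: group F by (rule F)
  have p0: "int p > 0" using prime_gt_0_nat[OF p] by simp
  interpret h: group_hom F "shift_semidirect (int p)" h
    using F h shift_semidirect_group[OF p0] by (simp add: group_hom_def group_hom_axioms_def)
  \<comment> \<open>The threads of the powers of \<open>w\<close>; in a finite cover two of them
    coincide, and the quotient of the two powers then lies in every iterated commutator
    subgroup.\<close>
  let ?s = "\<lambda>(n::nat) k. iter_commutator F R k #>\<^bsub>F\<^esub> (w [^]\<^bsub>F\<^esub> n)"
  have "range ?s \<subseteq> carrier (profinite_periodic_cover F R)"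
    using coset_sequence_in_cover[OF F R] w(1) by auto
  then have "\<not> inj ?s"
    using fin finite_imageD finite_subset infinite_UNIV_nat by blast
  then obtain n m where "n \<noteq> m" "?s n = ?s m"
    unfolding inj_def by blast
  then obtain n m where nm: "n < m" "?s n = ?s m"
    by (cases n m rule: linorder_cases) (blast dest: sym)+
  have mem: "w [^]\<^bsub>F\<^esub> (m - n) \<in> iter_commutator F R k" for k
  proof -
    interpret N: normal "iter_commutator F R k" F by (rule F.iter_commutator_normal[OF R])
    have "w [^]\<^bsub>F\<^esub> m \<in> iter_commutator F R k #>\<^bsub>F\<^esub> w [^]\<^bsub>F\<^esub> n"
      using F.rcos_self[of "w [^]\<^bsub>F\<^esub> m" "iter_commutator F R k"] N.subgroup_axioms w(1) fun_cong[OF nm(2), of k]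
      by simp
    then obtain r where r: "r \<in> iter_commutator F R k" "w [^]\<^bsub>F\<^esub> m = r \<otimes>\<^bsub>F\<^esub> w [^]\<^bsub>F\<^esub> n"
      by (auto simp: r_coset_def)
    have "w [^]\<^bsub>F\<^esub> m = w [^]\<^bsub>F\<^esub> (m - n) \<otimes>\<^bsub>F\<^esub> w [^]\<^bsub>F\<^esub> n"
      using nm(1) w(1) by (simp add: F.nat_pow_mult)
    then have "w [^]\<^bsub>F\<^esub> (m - n) = r"
      using r N.subset w(1) by (auto simp: subset_iff)
    then show ?thesis using r(1) by simp
  qed
  have "h (w [^]\<^bsub>F\<^esub> (m - n)) \<in> shift_series (int p) k" for k
  proof -
    have "R \<subseteq> carrier F" using R normal_imp_subgroup subgroup.subset by blast
    moreover have "shift_series (int p) 0 = carrier (shift_semidirect (int p))"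
      by (simp add: shift_series_def)
    ultimately have "h ` iter_commutator F R k \<subseteq> shift_series (int p) k"
      using iter_commutator_image[where L = "shift_series (int p)", OF h.group_hom_axioms]
        shift_series_subgroup[OF p0] shift_series_commutator[OF p0] by blast
    then show ?thesis using mem by blast
  qed
  moreover have "h (w [^]\<^bsub>F\<^esub> (m - n)) = (0, \<lambda>t. int (m - n) * u t)"
    using w by (simp add: h.hom_nat_pow shift_semidirect_translation_pow del: of_nat_diff)
  \<comment> \<open>Term 0 says nothing about differences; term \<open>Suc k\<close> puts the
    function in the image of \<open>fdiff ^^ k\<close>.\<close>
  ultimately have "(0, \<lambda>t. int (m - n) * u t) \<in> shift_series (int p) (Suc k)" for k
    by (simp only:)
  then have "int (m - n) * u 0 = 0"
    by (intro fdiff_image_inter_trivial[OF p, of "\<lambda>t. int (m - n) * u t"])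
      (auto simp: shift_series_def simp del: of_nat_diff)
  then show False using nm(1) w(3) by simp
qed

theorem theorem1p2:
  fixes G :: "('g, 'h) monoid_scheme"
    and F :: "('f, 'e) monoid_scheme"
    and \<pi> :: "'f \<Rightarrow> 'g"
    and I :: "'i set"
    and C :: "'i \<Rightarrow> ('c, 'd) monoid_scheme"
  assumes "group G" and "finite (carrier G)"
    and "\<not> cyclic_group (G Mod derived G (carrier G))"
    and "periodic_presentation I C F \<pi> G"
  shows "group (profinite_periodic_cover F (kernel F G \<pi>)) \<and>
    infinite (carrier (profinite_periodic_cover F (kernel F G \<pi>)))"
proof -
  interpret G: group G by fact
  let ?D = "derived G (carrier G)" and ?E = "free_product I C"
  have I: "finite I" and C: "\<And>i. i \<in> I \<Longrightarrow> group (C i)" "\<And>i. i \<in> I \<Longrightarrow> cyclic_group (C i)"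
    and F: "group F" and iso: "F \<cong> ?E" and epi: "\<pi> \<in> epi F G"
    using assms(4) by (auto simp: periodic_presentation_def)
  interpret F: group F by (rule F)
  interpret \<pi>: group_hom F G \<pi>
    using epi by (simp add: epi_def group_hom_def group_hom_axioms_def F assms(1))
  have R: "kernel F G \<pi> \<lhd> F" by (rule \<pi>.normal_kernel)
  obtain a where a: "\<And>i. i \<in> I \<Longrightarrow> a i \<in> carrier (C i)"
    "\<And>i. i \<in> I \<Longrightarrow> carrier (C i) = range (\<lambda>n::int. a i [^]\<^bsub>C i\<^esub> n)"
  proof -
    have "\<forall>i\<in>I. \<exists>x. x \<in> carrier (C i) \<and> carrier (C i) = range (\<lambda>n::int. x [^]\<^bsub>C i\<^esub> n)"
    proof
      fix i assume "i \<in> I"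
      then have "group (C i)" "cyclic_group (C i)" using C by auto
      then show "\<exists>x. x \<in> carrier (C i) \<and> carrier (C i) = range (\<lambda>n::int. x [^]\<^bsub>C i\<^esub> n)"
        using group.cyclic_group[of "C i"] by blast
    qed
    from bchoice[OF this] obtain a where
      "\<forall>i\<in>I. a i \<in> carrier (C i) \<and> carrier (C i) = range (\<lambda>n::int. a i [^]\<^bsub>C i\<^esub> n)" ..
    then show thesis by (intro that) auto
  qed
  \<comment> \<open>The two directions serve different purposes: \<open>\<theta>\<close> makes the
    abelianization of \<open>G\<close> a quotient of the free product, and \<open>\<psi>\<close>
    pulls the detecting homomorphism back to \<open>F\<close>.\<close>
  obtain \<psi> where \<psi>: "\<psi> \<in> iso F ?E" using iso by (auto simp: is_iso_def)
  obtain \<theta> where \<theta>: "\<theta> \<in> iso ?E F" using F.iso_sym[OF iso] by (auto simp: is_iso_def)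
  interpret D: normal ?D G by (rule G.derived_is_normal) (rule G.normal_self)
  have "(\<lambda>x. ?D #>\<^bsub>G\<^esub> x) \<circ> (\<pi> \<circ> \<theta>) \<in> epi ?E (G Mod ?D)"
  proof -
    have "(\<lambda>x. ?D #>\<^bsub>G\<^esub> x) \<in> epi G (G Mod ?D)"
      using D.r_coset_hom_Mod by (auto simp: epi_def FactGroup_def RCOSETS_def)
    moreover have "\<theta> \<in> epi ?E F" using \<theta> by (auto simp: epi_def iso_def bij_betw_def)
    ultimately show ?thesis by (intro epi_compose[OF epi_compose[OF _ epi]])
  qed
  \<comment> \<open>Pairwise coprime orders would make the abelianization of \<open>G\<close>
    cyclic.\<close>
  from cyclic_quotient_of_coprime_free_product[OF I C(1) a _ G.derived_quot_is_comm_group this] assms(3)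
  obtain i j where ij: "i \<in> I" "j \<in> I" "i \<noteq> j"
    "\<not> coprime (group.ord (C i) (a i)) (group.ord (C j) (a j))"
    by blast
  from ij(4) have "gcd (group.ord (C i) (a i)) (group.ord (C j) (a j)) \<noteq> 1"
    by (simp add: coprime_iff_gcd_eq_1)
  then obtain p where p: "Factorial_Ring.prime p" "p dvd group.ord (C i) (a i)" "p dvd group.ord (C j) (a j)"
    using prime_factor_nat by (meson dvd_trans gcd_dvd1 gcd_dvd2)
  from free_product_shift_semidirect_hom[OF p(1) C(1) ij(1-3) a p(2,3)]
  obtain h w u where h: "h \<in> hom ?E (shift_semidirect (int p))" and w: "w \<in> carrier ?E"
    and u: "h w = (0, u)" "u 0 \<noteq> 0" by blast
  have "w \<in> \<psi> ` carrier F" using \<psi> w by (simp add: iso_def bij_betw_def)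
  then obtain v where v: "v \<in> carrier F" "\<psi> v = w" by blast
  have "h \<circ> \<psi> \<in> hom F (shift_semidirect (int p))"
    using \<psi> by (intro hom_compose[OF _ h]) (simp add: iso_def)
  then show ?thesis
    using infinite_profinite_periodic_cover[OF p(1) F R _ v(1)] profinite_periodic_cover_group[OF F R] u v(2) by simp
qed

end
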